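(* Let $(\Omega,\mathcal F,\mu)$ be a probability space, $\Gamma$ a difference operator on a class $\mathcal A$ of bounded measurable functions on $\Omega$, and assume that $\mu$ satisfies a $\Gamma\mathrm{-mLSI}(\rho)$ for some $\rho>0$. Let $f\in\mathcal A$ and let $g:\Omega\to\mathbb R$ be measurable such that $\Gamma(f)\le g$ and such that for some $c>0$, $C\ge 1$ and $K>0$ $$\mu(g\ge c+t)\le C\exp\Big(-\frac{t^2}{2K^2}\Big)\qquad\text{for all } t\ge 0 .$$ Then for all $t\ge 0$ $$\mu\big(f-\mathbb E_\mu f\ge t\big)\le \frac{4C}{3}\exp\Big(-\frac18\min\Big(\frac{t^2}{\rho c^2},\frac{t}{\sqrt\rho K}\Big)\Big).$$ If moreover $ah\in\mathcal A$ and $\Gamma(ah)=|a|\Gamma(h)$ for all $h\in\mathcal A$ and $a\in\mathbb R$, then for all $t\ge0$ $$\mu\big(|f-\mathbb E_\mu f|\ge t\big)\le 2C\exp\Big(-\frac1{12}\min\Big(\frac{t^2}{\rho c^2},\frac{t}{\sqrt\rho K}\Big)\Big).$$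
   Context: An operator $\Gamma$ on a class $\mathcal A$ of bounded measurable functions on a probability space $(\Omega,\mathcal F,\mu)$ is called a difference operator if (1) for all $f\in\mathcal A$, $\Gamma(f)$ is a non-negative measurable function; (2) for all $f\in\mathcal A$, $a\ge0$, $b\in\mathbb R$ we have $af+b\in\mathcal A$ and $\Gamma(af+b)=a\Gamma(f)$. No chain rule is assumed. $\mathbb E_\mu$ denotes expectation with respect to $\mu$, and for $h\ge0$, $\mathrm{Ent}_\mu(h)=\mathbb E_\mu h\log h-\mathbb E_\mu h\,\log(\mathbb E_\mu h)$. $\mu$ satisfies a $\Gamma\mathrm{-mLSI}(\rho)$, $\rho>0$, if $\mathrm{Ent}_\mu(e^f)\le\frac\rho2\,\mathbb E_\mu\big(\Gamma(f)^2e^f\big)$ for all $f\in\mathcal A$. *)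

theory Defs
  imports "HOL-Probability.Probability"
begin

text \<open>
  A class of functions on \<open>\<Omega> = space M\<close> is a set of total functions on the underlying type.
  Only the values on \<open>space M\<close> are constrained: boundedness, non-negativity and all (in)equalities
  between functions are pointwise on \<open>space M\<close>.
\<close>

definition difference_operator ::
    "'a measure \<Rightarrow> ('a \<Rightarrow> real) set \<Rightarrow> (('a \<Rightarrow> real) \<Rightarrow> 'a \<Rightarrow> real) \<Rightarrow> bool" where
  "difference_operator M A \<Gamma> \<longleftrightarrow>
     (\<forall>f\<in>A. f \<in> borel_measurable M \<and> bounded (f ` space M)) \<and>
     (\<forall>f\<in>A. \<Gamma> f \<in> borel_measurable M \<and> (\<forall>x\<in>space M. 0 \<le> \<Gamma> f x)) \<and>
     (\<forall>f\<in>A. \<forall>a\<ge>0. \<forall>b. (\<lambda>x. a * f x + b) \<in> A \<and>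
        (\<forall>x\<in>space M. \<Gamma> (\<lambda>x. a * f x + b) x = a * \<Gamma> f x))"

text \<open>
  Meaningful when \<open>h\<close> and \<open>h log h\<close> are integrable; it is only applied to \<open>h = e\<^sup>f\<close> with \<open>f\<close> bounded.
  The convention \<open>0 log 0 = 0\<close> holds automatically.
\<close>

definition Ent :: "'a measure \<Rightarrow> ('a \<Rightarrow> real) \<Rightarrow> real" where
  "Ent M h = (\<integral>x. h x * ln (h x) \<partial>M) - (\<integral>x. h x \<partial>M) * ln (\<integral>x. h x \<partial>M)"

text \<open>
  \<open>\<Gamma> f\<close> need not be square integrable, so the right-hand side may be infinite, in which case the
  inequality is void; a Bochner integral would wrongly be \<open>0\<close> there. Truncation by \<open>ennreal\<close> on the
  left is harmless: for bounded \<open>f\<close> and a probability measure, \<open>Ent M (e\<^sup>f) \<ge> 0\<close> by Jensen.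
\<close>

definition mLSI ::
    "'a measure \<Rightarrow> ('a \<Rightarrow> real) set \<Rightarrow> (('a \<Rightarrow> real) \<Rightarrow> 'a \<Rightarrow> real) \<Rightarrow> real \<Rightarrow> bool" where
  "mLSI M A \<Gamma> \<rho> \<longleftrightarrow> \<rho> > 0 \<and>
     (\<forall>f\<in>A. ennreal (Ent M (\<lambda>x. exp (f x)))
        \<le> ennreal (\<rho> / 2) * (\<integral>\<^sup>+x. ennreal ((\<Gamma> f x)\<^sup>2 * exp (f x)) \<partial>M))"

end

theory Submission
  imports Defs
begin

text \<open>
  By the variational formula for the entropy, the mLSI yields
  \<open>Ent(e\<^sup>s\<^sup>f) \<le> s\<^sup>2 E e\<^sup>s\<^sup>f log E e\<^bsup>\<rho> \<Gamma>(f)\<^sup>2\<^esup>\<close> for \<open>0 \<le> s \<le> 1\<close>, and Herbst's argument turns this into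
  \<open>E e\<^bsup>f - E f\<^esup> \<le> E e\<^bsup>\<rho> \<Gamma>(f)\<^sup>2\<^esup>\<close> (Bobkov and Goetze). Applied to \<open>l f\<close>, with
  \<open>\<Gamma>(f)\<^sup>2 \<le> 2 c\<^sup>2 + 2 (g - c)\<^sub>+\<^sup>2\<close> and \<open>4 \<surd>\<rho> K l \<le> 1\<close>, the tail of \<open>g\<close> bounds the right-hand side by
  \<open>4 C / 3 e\<^bsup>2 \<rho> l\<^sup>2 c\<^sup>2\<^esup>\<close>; it remains to optimise Markov's inequality over \<open>l\<close>.
\<close>

section \<open>An exponential estimate and the scaling axioms\<close>

text \<open>Serves to dominate difference quotients of exponentials. It follows from
  \<open>1 + y \<le> exp y\<close>, taken at \<open>y = - x\<close> for nonnegative \<open>x\<close>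
  and at \<open>y = x\<close> for negative \<open>x\<close>.\<close>

lemma abs_exp_minus_one_le: "\<bar>exp x - 1\<bar> \<le> \<bar>x\<bar> * exp \<bar>x\<bar>" for x :: real
proof -
  have 1: "x \<le> exp x - 1" using exp_ge_add_one_self[of x] by linarith
  have "1 - x \<le> exp (- x)" using exp_ge_add_one_self[of "-x"] by linarith
  then have "(1 - x) * exp x \<le> exp (- x) * exp x" by (intro mult_right_mono) auto
  then have 2: "exp x - 1 \<le> x * exp x" by (simp add: algebra_simps flip: exp_add)
  show ?thesis
  proof (cases "x \<ge> 0")
    case True
    then show ?thesis using 1 2 by simp
  next
    case False
    have "- x * 1 \<le> - x * exp (- x)" using False by (intro mult_left_mono) auto
    moreover have "exp x \<le> 1" using False by simp
    ultimately have "1 - exp x \<le> - x * exp (- x)" using 1 by linarith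
    then show ?thesis using False by simp
  qed
qed

lemma difference_operatorD:
  assumes "difference_operator M A \<Gamma>" "f \<in> A"
  shows "f \<in> borel_measurable M" "bounded (f ` space M)"
    and "\<Gamma> f \<in> borel_measurable M" "\<And>x. x \<in> space M \<Longrightarrow> 0 \<le> \<Gamma> f x"
    and "0 \<le> a \<Longrightarrow> (\<lambda>x. a * f x) \<in> A"
    and "0 \<le> a \<Longrightarrow> x \<in> space M \<Longrightarrow> \<Gamma> (\<lambda>x. a * f x) x = a * \<Gamma> f x"
proof -
  have "(\<lambda>x. a * f x + 0) \<in> A \<and> (\<forall>x\<in>space M. \<Gamma> (\<lambda>x. a * f x + 0) x = a * \<Gamma> f x)" if "0 \<le> a"
    using assms that unfolding difference_operator_def by blast
  then show "0 \<le> a \<Longrightarrow> (\<lambda>x. a * f x) \<in> A"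
    and "0 \<le> a \<Longrightarrow> x \<in> space M \<Longrightarrow> \<Gamma> (\<lambda>x. a * f x) x = a * \<Gamma> f x"
    by simp_all
qed (use assms in \<open>auto simp: difference_operator_def\<close>)

section \<open>Moment generating functions of bounded functions\<close>

context prob_space
begin

lemma integrable_boundedI:
  fixes f :: "'a \<Rightarrow> real"
  assumes "f \<in> borel_measurable M" "\<And>x. x \<in> space M \<Longrightarrow> \<bar>f x\<bar> \<le> B"
  shows "integrable M f"
  using assms by (intro integrable_const_bound[where B = B]) auto

lemma integrable_exp_boundedI:
  fixes f :: "'a \<Rightarrow> real"
  assumes [measurable]: "f \<in> borel_measurable M" and B: "\<And>x. x \<in> space M \<Longrightarrow> \<bar>f x\<bar> \<le> B"
  shows "integrable M (\<lambda>x. exp (s * f x))"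
proof (rule integrable_boundedI)
  show "\<bar>exp (s * f x)\<bar> \<le> exp (\<bar>s\<bar> * B)" if "x \<in> space M" for x
  proof -
    have "s * f x \<le> \<bar>s\<bar> * \<bar>f x\<bar>" by (metis abs_ge_self abs_mult)
    also have "\<dots> \<le> \<bar>s\<bar> * B" using B[OF that] by (intro mult_left_mono) auto
    finally show ?thesis by simp
  qed
qed measurable

lemma mgf_pos:
  assumes "integrable M (\<lambda>x. exp (v x))"
  shows "0 < expectation (\<lambda>x. exp (v x :: real))"
  using assms by (intro expectation_greater) auto

text \<open>Differentiation under the integral sign by dominated convergence along sequences of
  increments; the boundedness of \<open>F\<close> supplies the integrable majorant.\<close>

lemma has_real_derivative_mgf:
  fixes F :: "'a \<Rightarrow> real"
  assumes [measurable]: "F \<in> borel_measurable M"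
    and B: "\<And>x. x \<in> space M \<Longrightarrow> \<bar>F x\<bar> \<le> B"
  shows "((\<lambda>s. expectation (\<lambda>x. exp (s * F x))) has_real_derivative
           expectation (\<lambda>x. F x * exp (s * F x))) (at s)"
proof -
  have int: "integrable M (\<lambda>x. exp (r * F x))" for r
    using B by (intro integrable_exp_boundedI) auto
  have quot: "(expectation (\<lambda>x. exp ((s + h) * F x)) - expectation (\<lambda>x. exp (s * F x))) / h
        = expectation (\<lambda>x. (exp ((s + h) * F x) - exp (s * F x)) / h)" for h
    using int by simp
  have "((\<lambda>h. expectation (\<lambda>x. (exp ((s + h) * F x) - exp (s * F x)) / h)) \<longlongrightarrow>
          expectation (\<lambda>x. F x * exp (s * F x))) (at 0)"
    unfolding tendsto_at_iff_sequentially comp_def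
  proof (intro allI impI)
    fix h :: "nat \<Rightarrow> real"
    assume h0: "\<forall>i. h i \<in> UNIV - {0}" and h: "h \<longlonglongrightarrow> 0"
    \<comment> \<open>A convergent sequence of increments is bounded, so one majorant serves for all
      \<open>i\<close>.\<close>
    obtain D where D: "\<And>i. \<bar>h i\<bar> \<le> D"
      using h by (metis convergentI convergent_imp_Bseq BseqE real_norm_def)
    show "(\<lambda>i. expectation (\<lambda>x. (exp ((s + h i) * F x) - exp (s * F x)) / h i)) \<longlonglongrightarrow>
          expectation (\<lambda>x. F x * exp (s * F x))"
    proof (rule integral_dominated_convergence[where w = "\<lambda>x. exp (s * F x) * (B * exp (D * B))"])
      show "integrable M (\<lambda>x. exp (s * F x) * (B * exp (D * B)))"
        using int by simp
      show "AE x in M. (\<lambda>i. (exp ((s + h i) * F x) - exp (s * F x)) / h i)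
              \<longlonglongrightarrow> F x * exp (s * F x)"
      proof (rule AE_I2)
        fix x
        have "((\<lambda>r. exp (r * F x)) has_real_derivative (F x * exp (s * F x))) (at s)"
          by (auto intro!: derivative_eq_intros)
        then have "((\<lambda>e. (exp ((s + e) * F x) - exp (s * F x)) / e)
            \<longlongrightarrow> F x * exp (s * F x)) (at 0)"
          by (simp add: DERIV_def)
        then show "(\<lambda>i. (exp ((s + h i) * F x) - exp (s * F x)) / h i)
              \<longlonglongrightarrow> F x * exp (s * F x)"
          using h0 h unfolding tendsto_at_iff_sequentially comp_def by blast
      qed
      show "AE x in M. norm ((exp ((s + h i) * F x) - exp (s * F x)) / h i)
              \<le> exp (s * F x) * (B * exp (D * B))" for i
      proof (rule AE_I2)
        fix x assume x: "x \<in> space M"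
        have B0: "0 \<le> B" using B[OF x] by linarith
        have hF: "\<bar>h i * F x\<bar> \<le> \<bar>h i\<bar> * B"
          unfolding abs_mult using B[OF x] by (intro mult_left_mono) auto
        have "exp ((s + h i) * F x) - exp (s * F x) = exp (s * F x) * (exp (h i * F x) - 1)"
          by (simp add: algebra_simps exp_add)
        then have "norm ((exp ((s + h i) * F x) - exp (s * F x)) / h i)
            = exp (s * F x) * (\<bar>exp (h i * F x) - 1\<bar> / \<bar>h i\<bar>)"
          by (simp add: abs_mult)
        also have "\<bar>exp (h i * F x) - 1\<bar> \<le> (\<bar>h i\<bar> * B) * exp (D * B)"
        proof (rule order_trans[OF abs_exp_minus_one_le mult_mono])
          have "\<bar>h i\<bar> * B \<le> D * B" using D B0 by (intro mult_right_mono) auto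
          then show "exp \<bar>h i * F x\<bar> \<le> exp (D * B)" using hF by simp
        qed (use hF B0 in auto)
        then have "\<bar>exp (h i * F x) - 1\<bar> / \<bar>h i\<bar> \<le> B * exp (D * B)"
          using h0 by (simp add: field_simps)
        finally show "norm ((exp ((s + h i) * F x) - exp (s * F x)) / h i)
              \<le> exp (s * F x) * (B * exp (D * B))" by simp
      qed
    qed measurable
  qed
  then show ?thesis by (simp add: DERIV_def quot)
qed

section \<open>Duality between entropy and exponential moments\<close>

text \<open>One half of the Gibbs (Donsker-Varadhan) variational formula, left unnormalised. It is
  \<open>1 + d \<le> exp d\<close> integrated against \<open>exp (u x)\<close>, with
  \<open>d\<close> the logarithm of a ratio of two densities. Nonnegativity of \<open>W\<close>
  gives \<open>W x * exp (u x)\<close> the integrable majorant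
  \<open>exp (W x) * exp B\<close>.\<close>

lemma entropy_variational_le:
  fixes u W :: "'a \<Rightarrow> real"
  assumes [measurable]: "u \<in> borel_measurable M" "W \<in> borel_measurable M"
    and B: "\<And>x. x \<in> space M \<Longrightarrow> \<bar>u x\<bar> \<le> B"
    and W0: "\<And>x. x \<in> space M \<Longrightarrow> 0 \<le> W x"
    and intW: "integrable M (\<lambda>x. exp (W x))"
  shows "integrable M (\<lambda>x. W x * exp (u x))"
    and "expectation (\<lambda>x. W x * exp (u x)) \<le> Ent M (\<lambda>x. exp (u x))
           + expectation (\<lambda>x. exp (u x)) * ln (expectation (\<lambda>x. exp (W x)))"
proof -
  have eu: "exp (u x) \<le> exp B" if "x \<in> space M" for x using B[OF that] by simp
  show int1: "integrable M (\<lambda>x. W x * exp (u x))"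
  proof (rule Bochner_Integration.integrable_bound)
    show "integrable M (\<lambda>x. exp (W x) * exp B)" using intW by simp
    show "AE x in M. norm (W x * exp (u x)) \<le> norm (exp (W x) * exp B)"
    proof (rule AE_I2)
      fix x assume x: "x \<in> space M"
      have "W x \<le> exp (W x)" using exp_ge_add_one_self[of "W x"] by linarith
      then show "norm (W x * exp (u x)) \<le> norm (exp (W x) * exp B)"
        using W0[OF x] eu[OF x] by (auto simp: abs_mult intro!: mult_mono)
    qed
  qed measurable
  have int2: "integrable M (\<lambda>x. exp (u x))"
    by (rule integrable_boundedI[of _ "exp B"]) (use eu in auto)
  have int3: "integrable M (\<lambda>x. exp (u x) * u x)"
  proof (rule integrable_boundedI[of _ "exp B * B"])
    show "\<bar>exp (u x) * u x\<bar> \<le> exp B * B" if "x \<in> space M" for x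
      unfolding abs_mult using eu[OF that] B[OF that] by (intro mult_mono) auto
  qed measurable
  define m where "m = expectation (\<lambda>x. exp (u x))"
  define Z where "Z = expectation (\<lambda>x. exp (W x))"
  have m: "m > 0" and Z: "Z > 0" unfolding m_def Z_def using int2 intW by (auto intro!: mgf_pos)
  have "expectation (\<lambda>x. W x * exp (u x) - exp (u x) * u x + (ln m - ln Z) * exp (u x))
      \<le> expectation (\<lambda>x. exp (W x) * (m / Z) - exp (u x))"
  proof (rule integral_mono)
    fix x
    \<comment> \<open>\<open>exp d\<close> is the ratio of the normalised densities
      \<open>exp (W x) / Z\<close> and \<open>exp (u x) / m\<close>, so the upper bound obtained
      from it integrates to \<open>m - m = 0\<close>.\<close>
    define d where "d = W x - ln Z + ln m - u x"
    have "exp (u x) * d \<le> exp (u x) * (exp d - 1)"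
      using exp_ge_add_one_self[of d] by (intro mult_left_mono) (linarith, simp)
    also have "\<dots> = exp (W x) * (m / Z) - exp (u x)"
      using m Z by (simp add: d_def exp_add exp_diff algebra_simps)
    finally show "W x * exp (u x) - exp (u x) * u x + (ln m - ln Z) * exp (u x)
        \<le> exp (W x) * (m / Z) - exp (u x)"
      by (simp add: d_def algebra_simps)
  qed (use int1 int2 int3 intW in auto)
  also have "\<dots> = Z * (m / Z) - m"
    using int2 intW by (simp add: m_def Z_def)
  also have "\<dots> = 0" using Z by simp
  finally have "expectation (\<lambda>x. W x * exp (u x)) - expectation (\<lambda>x. exp (u x) * u x)
      + (ln m - ln Z) * m \<le> 0"
    using int1 int2 int3 by (simp add: m_def)
  then show "expectation (\<lambda>x. W x * exp (u x)) \<le> Ent M (\<lambda>x. exp (u x))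
           + expectation (\<lambda>x. exp (u x)) * ln (expectation (\<lambda>x. exp (W x)))"
    by (simp add: Ent_def m_def Z_def algebra_simps)
qed

section \<open>From tail bounds to exponential moments\<close>

text \<open>Layer-cake formula and Tonelli: the weight \<open>u * exp (u * t)\<close> is integrated
  against the tail \<open>C * exp (- t)\<close>, which converges because \<open>u < 1\<close>. With
  a nonnegative integral, finiteness comes out as a conclusion.\<close>

lemma nn_integral_exp_tail_le:
  fixes X :: "'a \<Rightarrow> real"
  assumes [measurable]: "X \<in> borel_measurable M"
    and X0: "\<And>x. x \<in> space M \<Longrightarrow> 0 \<le> X x"
    and tail: "\<And>t. 0 \<le> t \<Longrightarrow> prob {x \<in> space M. X x \<ge> t} \<le> C * exp (- t)"
    and C: "C \<ge> 1" and u: "0 \<le> u" "u < 1"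
  shows "(\<integral>\<^sup>+x. ennreal (exp (u * X x)) \<partial>M) \<le> ennreal (C / (1 - u))"
proof -
  interpret lb: pair_sigma_finite M lborel ..
  have layer: "ennreal (exp (u * X x)) =
      1 + (\<integral>\<^sup>+t. ennreal (u * exp (u * t)) * indicator {0..X x} t \<partial>lborel)"
    if "x \<in> space M" for x
  proof -
    have "(\<integral>\<^sup>+t. ennreal (u * exp (u * t)) * indicator {0..X x} t \<partial>lborel)
        = ennreal (exp (u * X x) - exp (u * 0))"
      using u X0[OF that]
      by (intro nn_integral_FTC_Icc) (auto intro!: derivative_eq_intros)
    moreover have "1 \<le> exp (u * X x)" using u X0[OF that] by simp
    ultimately show ?thesis
      by (simp flip: ennreal_1 ennreal_plus)
  qed
  have "(\<integral>\<^sup>+x. ennreal (exp (u * X x)) \<partial>M) =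
      (\<integral>\<^sup>+x. 1 + (\<integral>\<^sup>+t. ennreal (u * exp (u * t)) * indicator {0..X x} t \<partial>lborel) \<partial>M)"
    by (intro nn_integral_cong layer)
  also have "\<dots> = 1 + (\<integral>\<^sup>+x. (\<integral>\<^sup>+t. ennreal (u * exp (u * t)) * indicator {0..X x} t \<partial>lborel) \<partial>M)"
    by (subst nn_integral_add) (auto simp: emeasure_space_1 indicator_def)
  also have "(\<integral>\<^sup>+x. (\<integral>\<^sup>+t. ennreal (u * exp (u * t)) * indicator {0..X x} t \<partial>lborel) \<partial>M)
      = (\<integral>\<^sup>+t. (\<integral>\<^sup>+x. ennreal (u * exp (u * t)) * indicator {0..X x} t \<partial>M) \<partial>lborel)"
    by (rule lb.Fubini'[symmetric]) (simp add: indicator_def, measurable)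
  also have "\<dots> \<le> (\<integral>\<^sup>+t. ennreal (C * u * exp (- (1 - u) * t)) * indicator {0..} t \<partial>lborel)"
  proof (rule nn_integral_mono)
    fix t :: real
    show "(\<integral>\<^sup>+x. ennreal (u * exp (u * t)) * indicator {0..X x} t \<partial>M)
        \<le> ennreal (C * u * exp (- (1 - u) * t)) * indicator {0..} t"
    proof (cases "t \<ge> 0")
      case True
      have "(\<integral>\<^sup>+x. ennreal (u * exp (u * t)) * indicator {0..X x} t \<partial>M)
          = (\<integral>\<^sup>+x. ennreal (u * exp (u * t)) * indicator {x \<in> space M. X x \<ge> t} x \<partial>M)"
        using True by (intro nn_integral_cong) (auto simp: indicator_def)
      also have "\<dots> = ennreal (u * exp (u * t)) * ennreal (prob {x \<in> space M. X x \<ge> t})"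
        by (subst nn_integral_cmult_indicator) (auto simp: emeasure_eq_measure)
      also have "\<dots> \<le> ennreal (u * exp (u * t)) * ennreal (C * exp (- t))"
        using tail[OF True] by (intro mult_left_mono ennreal_leI) auto
      also have "\<dots> = ennreal (C * u * exp (- (1 - u) * t))"
        using u C by (simp add: algebra_simps exp_add exp_diff exp_minus divide_simps flip: ennreal_mult)
      finally show ?thesis using True by simp
    qed simp
  qed
  \<comment> \<open>The antiderivative \<open>- (C * u / (1 - u)) * exp (- (1 - u) * t)\<close>
    vanishes at infinity, so only its value at \<open>0\<close> contributes.\<close>
  also have "\<dots> = ennreal (0 - (- (C * u / (1 - u)) * exp (- (1 - u) * 0)))"
  proof (rule nn_integral_FTC_atLeast)
    have "((\<lambda>t. exp (- (1 - u) * t)) \<longlongrightarrow> 0) at_top"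
      using u by (intro filterlim_compose[OF exp_at_bot] filterlim_tendsto_neg_mult_at_bot[OF tendsto_const])
         (auto simp: filterlim_ident)
    then show "((\<lambda>t. - (C * u / (1 - u)) * exp (- (1 - u) * t)) \<longlongrightarrow> 0) at_top"
      by (rule tendsto_mult_right_zero)
    show "((\<lambda>t. - (C * u / (1 - u)) * exp (- (1 - u) * t)) has_real_derivative
        C * u * exp (- (1 - u) * t)) (at t)" for t
    proof -
      define a where "a = C * u / (1 - u)"
      have a: "C * u = a * (1 - u)" using u by (simp add: a_def)
      show ?thesis
        unfolding a_def[symmetric] a by (auto intro!: derivative_eq_intros) (simp add: algebra_simps)
    qed
  qed (use u C in auto)
  also have "1 + \<dots> = ennreal (1 + C * u / (1 - u))"
    using u C by (simp flip: ennreal_1 ennreal_plus)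
  also have "\<dots> \<le> ennreal (C / (1 - u))"
  proof (rule ennreal_leI)
    \<comment> \<open>The constant \<open>1\<close> from the layer-cake formula is absorbed using
      \<open>1 \<le> C\<close>.\<close>
    have "1 + C * u / (1 - u) \<le> C + C * u / (1 - u)" using C by simp
    also have "\<dots> = C / (1 - u)" using u by (simp add: divide_simps algebra_simps)
    finally show "1 + C * u / (1 - u) \<le> C / (1 - u)" .
  qed
  finally show ?thesis by (simp add: add_left_mono)
qed

section \<open>Herbst's argument under the mLSI\<close>

text \<open>
  Testing the variational inequality against \<open>W = \<rho> \<Gamma>(f)\<^sup>2\<close> at \<open>u = s f\<close> with \<open>s \<le> 1\<close>
  leaves half of the entropy to be absorbed on the left.
\<close>
lemma mLSI_Ent_le:
  assumes diff: "difference_operator M A \<Gamma>" and lsi: "mLSI M A \<Gamma> \<rho>" and f: "f \<in> A"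
    and int: "integrable M (\<lambda>x. exp (\<rho> * (\<Gamma> f x)\<^sup>2))"
    and s: "0 \<le> s" "s \<le> 1"
  shows "Ent M (\<lambda>x. exp (s * f x)) \<le> s\<^sup>2 * expectation (\<lambda>x. exp (s * f x))
           * ln (expectation (\<lambda>x. exp (\<rho> * (\<Gamma> f x)\<^sup>2)))"
proof -
  note [measurable] = difference_operatorD(1,3)[OF diff f]
  note sf = difference_operatorD(5,6)[OF diff f s(1)]
  have \<rho>: "\<rho> > 0" using lsi by (simp add: mLSI_def)
  obtain B where B: "\<And>x. x \<in> space M \<Longrightarrow> \<bar>s * f x\<bar> \<le> B"
    using difference_operatorD(2)[OF diff sf(1)] by (auto simp: bounded_iff)
  define E where "E = Ent M (\<lambda>x. exp (s * f x))"
  define m where "m = expectation (\<lambda>x. exp (s * f x))"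
  define L where "L = ln (expectation (\<lambda>x. exp (\<rho> * (\<Gamma> f x)\<^sup>2)))"
  define I where "I = expectation (\<lambda>x. (\<Gamma> f x)\<^sup>2 * exp (s * f x))"
  have var: "integrable M (\<lambda>x. \<rho> * (\<Gamma> f x)\<^sup>2 * exp (s * f x))"
    "expectation (\<lambda>x. \<rho> * (\<Gamma> f x)\<^sup>2 * exp (s * f x)) \<le> E + m * L"
    unfolding E_def m_def L_def
    by (rule entropy_variational_le[OF _ _ B _ int]; use \<rho> in simp)+
  have intI: "integrable M (\<lambda>x. (\<Gamma> f x)\<^sup>2 * exp (s * f x))"
    using var(1) \<rho> by (simp add: mult.assoc)
  have \<rho>I: "\<rho> * I \<le> E + m * L"
    using var(2) by (simp add: I_def mult.assoc)
  have I0: "0 \<le> I" unfolding I_def by (intro integral_nonneg_AE) auto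
  have "ennreal E \<le> ennreal (\<rho> / 2) *
      (\<integral>\<^sup>+x. ennreal ((\<Gamma> (\<lambda>x. s * f x) x)\<^sup>2 * exp (s * f x)) \<partial>M)"
    using lsi[unfolded mLSI_def, THEN conjunct2, rule_format, OF sf(1)] by (simp add: E_def)
  \<comment> \<open>Homogeneity of \<Gamma> is the source of the factor \<open>s\<^sup>2\<close>
    that Herbst's argument needs. Since \<open>intI\<close> holds, the right-hand side is finite and
    the inequality can be read over the reals.\<close>
  also have "(\<integral>\<^sup>+x. ennreal ((\<Gamma> (\<lambda>x. s * f x) x)\<^sup>2 * exp (s * f x)) \<partial>M)
      = (\<integral>\<^sup>+x. ennreal (s\<^sup>2 * ((\<Gamma> f x)\<^sup>2 * exp (s * f x))) \<partial>M)"
    by (intro nn_integral_cong) (simp add: sf(2) power_mult_distrib mult.assoc)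
  also have "\<dots> = ennreal (s\<^sup>2 * I)"
    using intI by (subst nn_integral_eq_integral) (auto simp: I_def)
  also have "ennreal (\<rho> / 2) * \<dots> = ennreal (s\<^sup>2 / 2 * (\<rho> * I))"
    using \<rho> I0 by (simp add: mult_ac flip: ennreal_mult)
  finally have "E \<le> s\<^sup>2 / 2 * (\<rho> * I)"
    using \<rho> I0 by (simp add: ennreal_le_iff)
  also have "\<dots> \<le> s\<^sup>2 / 2 * (E + m * L)"
    using \<rho>I by (intro mult_left_mono) auto
  finally have E1: "E \<le> s\<^sup>2 / 2 * (E + m * L)" .
  \<comment> \<open>Bounding \<open>s\<^sup>2 / 2 * E\<close> by \<open>E / 2\<close> requires
    \<open>0 \<le> E\<close>. If instead \<open>E < 0\<close>, then
    \<open>0 \<le> \<rho> * I \<le> E + m * L\<close> forces \<open>m * L\<close> to be nonnegative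
    and the claim is trivial.\<close>
  have "E \<le> s\<^sup>2 * (m * L)"
  proof (cases "0 \<le> E")
    case True
    have "s\<^sup>2 * E \<le> 1 * E" using True s by (intro mult_right_mono) (auto simp: power_le_one)
    then show ?thesis using E1 by (simp add: algebra_simps)
  next
    case False
    have "0 \<le> \<rho> * I" using \<rho> I0 by simp
    then have "0 \<le> m * L" using \<rho>I False by linarith
    then show ?thesis using False by (smt (verit) mult_nonneg_nonneg zero_le_power2)
  qed
  then show ?thesis by (simp add: E_def m_def L_def mult.assoc)
qed

text \<open>
  Herbst argument: with \<open>L\<close> the logarithm of the right-hand side, \<open>(log E e\<^sup>s\<^sup>f) / s - L s\<close> is
  nonincreasing in \<open>s\<close> by the previous lemma, with limit \<open>E f\<close> at \<open>0\<close>.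
\<close>
lemma mLSI_mgf_le:
  assumes diff: "difference_operator M A \<Gamma>" and lsi: "mLSI M A \<Gamma> \<rho>" and f: "f \<in> A"
    and int: "integrable M (\<lambda>x. exp (\<rho> * (\<Gamma> f x)\<^sup>2))"
  shows "expectation (\<lambda>x. exp (f x - expectation f)) \<le> expectation (\<lambda>x. exp (\<rho> * (\<Gamma> f x)\<^sup>2))"
proof -
  note [measurable] = difference_operatorD(1,3)[OF diff f]
  obtain B where B: "\<And>x. x \<in> space M \<Longrightarrow> \<bar>f x\<bar> \<le> B"
    using difference_operatorD(2)[OF diff f] by (auto simp: bounded_iff)
  define \<phi> where "\<phi> s = expectation (\<lambda>x. exp (s * f x))" for s
  define \<phi>' where "\<phi>' s = expectation (\<lambda>x. f x * exp (s * f x))" for s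
  define L where "L = ln (expectation (\<lambda>x. exp (\<rho> * (\<Gamma> f x)\<^sup>2)))"
  have int\<phi>: "integrable M (\<lambda>x. exp (s * f x))" for s
    using B by (intro integrable_exp_boundedI) auto
  have \<phi>_pos: "0 < \<phi> s" for s unfolding \<phi>_def by (rule mgf_pos[OF int\<phi>])
  have D\<phi>: "(\<phi> has_real_derivative \<phi>' s) (at s)" for s
    using has_real_derivative_mgf[of f B s] B unfolding \<phi>_def[abs_def] \<phi>'_def by simp
  have \<phi>0: "\<phi> 0 = 1" "\<phi>' 0 = expectation f" by (simp_all add: \<phi>_def \<phi>'_def prob_space)
  define H where "H s = ln (\<phi> s) / s - L * s" for s
  have D_ln: "((\<lambda>s. ln (\<phi> s)) has_real_derivative \<phi>' s / \<phi> s) (at s)" for s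
    using \<phi>_pos[of s] by (auto intro!: derivative_eq_intros D\<phi>)
  \<comment> \<open>Since \<open>ln (\<phi> 0) = 0\<close>, this is the difference quotient of
    \<open>ln \<phi>\<close> at \<open>0\<close>, where the derivative is the mean of
    \<open>f\<close>.\<close>
  have "((\<lambda>s. ln (\<phi> s) / s) \<longlongrightarrow> expectation f) (at_right 0)"
    using D_ln[of 0] \<phi>0 by (auto simp: DERIV_def intro: filterlim_at_split[THEN iffD1, THEN conjunct2])
  then have lim: "(H \<longlongrightarrow> expectation f - L * 0) (at_right 0)"
    unfolding H_def[abs_def] by (intro tendsto_intros)
  have H_le: "H 1 \<le> H s" if s: "0 < s" "s < 1" for s
  proof (rule DERIV_nonpos_imp_nonincreasing[where f = H])
    fix r assume r: "s \<le> r" "r \<le> 1"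
    then have r0: "0 < r" using s by linarith
    \<comment> \<open>The entropy equals \<open>r\<^sup>2 * \<phi> r\<close> times the derivative of
      \<open>ln (\<phi> r) / r\<close>. Dividing the entropy bound by
      \<open>r\<^sup>2 * \<phi> r\<close> therefore says exactly that \<open>H\<close> has
      nonpositive derivative.\<close>
    have "Ent M (\<lambda>x. exp (r * f x)) = r * \<phi>' r - \<phi> r * ln (\<phi> r)"
      by (simp add: Ent_def \<phi>_def \<phi>'_def mult_ac)
    then have "r * \<phi>' r - \<phi> r * ln (\<phi> r) \<le> r\<^sup>2 * \<phi> r * L"
      using mLSI_Ent_le[OF diff lsi f int, of r] r r0 by (simp add: \<phi>_def L_def)
    then have "(r * \<phi>' r - \<phi> r * ln (\<phi> r) - r\<^sup>2 * \<phi> r * L) / (r\<^sup>2 * \<phi> r) \<le> 0"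
      using \<phi>_pos[of r] by (intro divide_nonpos_nonneg) auto
    moreover have "(H has_real_derivative (\<phi>' r / \<phi> r * r - ln (\<phi> r)) / (r * r) - L) (at r)"
      unfolding H_def[abs_def] using r0 DERIV_diff[OF DERIV_divide[OF D_ln DERIV_ident] DERIV_cmult_Id[of L r]] by simp
    moreover have "(\<phi>' r / \<phi> r * r - ln (\<phi> r)) / (r * r) - L
        = (r * \<phi>' r - \<phi> r * ln (\<phi> r) - r\<^sup>2 * \<phi> r * L) / (r\<^sup>2 * \<phi> r)"
      using \<phi>_pos[of r] r0 by (simp add: divide_simps power2_eq_square)
    ultimately show "\<exists>y. (H has_real_derivative y) (at r) \<and> y \<le> 0" by metis
  qed (use s in auto)
  have "\<forall>\<^sub>F s in at_right 0. H 1 \<le> H s"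
    using H_le by (intro eventually_at_rightI[of 0 1]) auto
  then have "H 1 \<le> expectation f"
    using tendsto_lowerbound[OF lim] by simp
  then have "ln (\<phi> 1) \<le> expectation f + L" by (simp add: H_def)
  then have "exp (ln (\<phi> 1)) \<le> exp (expectation f + L)" by simp
  then have "\<phi> 1 \<le> exp (expectation f) * exp L" using \<phi>_pos[of 1] by (simp add: exp_add)
  moreover have "exp L = expectation (\<lambda>x. exp (\<rho> * (\<Gamma> f x)\<^sup>2))"
    unfolding L_def using mgf_pos[OF int] by simp
  moreover have "expectation (\<lambda>x. exp (f x - expectation f)) = \<phi> 1 / exp (expectation f)"
    by (simp add: \<phi>_def exp_diff)
  ultimately show ?thesis by (simp add: divide_le_eq mult.commute)
qed

section \<open>The one-sided concentration inequality\<close>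

text \<open>The Gaussian tail of \<open>g\<close> above \<open>c\<close> is an exponential tail for
  \<open>(Y x)\<^sup>2 / (2 * K\<^sup>2)\<close>, with \<open>Y\<close> the positive part of
  \<open>g - c\<close>. The restriction on \<open>l\<close> keeps the exponent \<open>u\<close> of
  this variable at most \<open>1 / 4\<close>, whence \<open>1 / (1 - u) \<le> 4 / 3\<close>.\<close>

lemma mLSI_centred_mgf_le:
  assumes diff: "difference_operator M A \<Gamma>" and lsi: "mLSI M A \<Gamma> \<rho>" and f: "f \<in> A"
    and [measurable]: "g \<in> borel_measurable M"
    and \<Gamma>g: "\<And>x. x \<in> space M \<Longrightarrow> \<Gamma> f x \<le> g x"
    and c: "c > 0" and C: "C \<ge> 1" and K: "K > 0"
    and tail: "\<And>t. t \<ge> 0 \<Longrightarrow> prob {x \<in> space M. g x \<ge> c + t} \<le> C * exp (- (t\<^sup>2 / (2 * K\<^sup>2)))"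
    and l: "0 \<le> l" "4 * sqrt \<rho> * K * l \<le> 1"
  shows "expectation (\<lambda>x. exp (l * f x - l * expectation f)) \<le> 4 * C / 3 * exp (2 * \<rho> * l\<^sup>2 * c\<^sup>2)"
proof -
  have \<rho>: "\<rho> > 0" using lsi by (simp add: mLSI_def)
  note [measurable] = difference_operatorD(1,3)[OF diff f]
  note lf = difference_operatorD(5,6)[OF diff f l(1)]
  note [measurable] = difference_operatorD(1,3)[OF diff lf(1)]
  define Y where "Y x = max (g x - c) 0" for x
  \<comment> \<open>Chosen so that \<open>2 * \<rho> * l\<^sup>2 * (Y x)\<^sup>2 = u * ((Y
    x)\<^sup>2 / (2 * K\<^sup>2))\<close>; moreover \<open>4 * u\<close> is the square of
    \<open>4 * sqrt \<rho> * K * l\<close>.\<close>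
  define u where "u = 4 * \<rho> * l\<^sup>2 * K\<^sup>2"
  have [measurable]: "Y \<in> borel_measurable M" unfolding Y_def[abs_def] by measurable
  have "(4 * sqrt \<rho> * K * l)\<^sup>2 \<le> 1" using l \<rho> K by (intro power_le_one) auto
  then have u: "0 \<le> u" "u \<le> 1 / 4" using \<rho> by (simp_all add: u_def power_mult_distrib mult_ac)
  have "(\<integral>\<^sup>+x. ennreal (exp (u * ((Y x)\<^sup>2 / (2 * K\<^sup>2)))) \<partial>M) \<le> ennreal (C / (1 - u))"
  proof (rule nn_integral_exp_tail_le)
    fix t :: real assume t: "0 \<le> t"
    show "prob {x \<in> space M. (Y x)\<^sup>2 / (2 * K\<^sup>2) \<ge> t} \<le> C * exp (- t)"
    \<comment> \<open>At \<open>t = 0\<close> the event is the whole space, since \<open>Y\<close>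
      is truncated at \<open>0\<close>, and \<open>C \<ge> 1\<close> suffices. The translation into
      an event about \<open>g\<close> needs a positive level \<open>r\<close>.\<close>
    proof (cases "t = 0")
      case True
      then show ?thesis using C by (auto intro: order_trans[OF prob_le_1])
    next
      case False
      define r where "r = K * sqrt (2 * t)"
      have r: "0 < r" "r\<^sup>2 = t * (2 * K\<^sup>2)" using False t K by (auto simp: r_def power_mult_distrib)
      have "(Y x)\<^sup>2 / (2 * K\<^sup>2) \<ge> t \<longleftrightarrow> g x \<ge> c + r" for x
      proof -
        have "(Y x)\<^sup>2 / (2 * K\<^sup>2) \<ge> t \<longleftrightarrow> r\<^sup>2 \<le> (Y x)\<^sup>2" using K by (simp add: r(2) field_simps)
        also have "\<dots> \<longleftrightarrow> r \<le> Y x" using r(1) by (intro power_mono_iff) (auto simp: Y_def)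
        also have "\<dots> \<longleftrightarrow> g x \<ge> c + r" using r(1) by (auto simp: Y_def max_def)
        finally show ?thesis .
      qed
      then show ?thesis using tail[of r] r K by simp
    qed
  qed (use u C in auto)
  also have "\<dots> \<le> ennreal (4 * C / 3)"
    using u C by (intro ennreal_leI) (simp add: field_simps)
  finally have nnY: "(\<integral>\<^sup>+x. ennreal (exp (u * ((Y x)\<^sup>2 / (2 * K\<^sup>2)))) \<partial>M) \<le> ennreal (4 * C / 3)" .
  have pt: "exp (\<rho> * (\<Gamma> (\<lambda>x. l * f x) x)\<^sup>2)
      \<le> exp (2 * \<rho> * l\<^sup>2 * c\<^sup>2) * exp (u * ((Y x)\<^sup>2 / (2 * K\<^sup>2)))" if x: "x \<in> space M" for x
  proof -
    have "\<Gamma> f x \<le> c + Y x" using \<Gamma>g[OF x] by (simp add: Y_def)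
    then have "(\<Gamma> f x)\<^sup>2 \<le> (c + Y x)\<^sup>2"
      using difference_operatorD(4)[OF diff f x] by (intro power_mono) auto
    also have "\<dots> \<le> 2 * c\<^sup>2 + 2 * (Y x)\<^sup>2"
      using zero_le_power2[of "c - Y x"] by (simp add: power2_sum power2_diff)
    finally have "\<rho> * l\<^sup>2 * (\<Gamma> f x)\<^sup>2 \<le> \<rho> * l\<^sup>2 * (2 * c\<^sup>2 + 2 * (Y x)\<^sup>2)"
      using \<rho> by (intro mult_left_mono) auto
    also have "\<dots> = 2 * \<rho> * l\<^sup>2 * c\<^sup>2 + u * ((Y x)\<^sup>2 / (2 * K\<^sup>2))"
      using K by (simp add: u_def field_simps)
    finally show ?thesis using lf(2)[OF x] by (simp add: power_mult_distrib mult.assoc flip: exp_add)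
  qed
  have "(\<integral>\<^sup>+x. ennreal (exp (\<rho> * (\<Gamma> (\<lambda>x. l * f x) x)\<^sup>2)) \<partial>M)
      \<le> (\<integral>\<^sup>+x. ennreal (exp (2 * \<rho> * l\<^sup>2 * c\<^sup>2)) * ennreal (exp (u * ((Y x)\<^sup>2 / (2 * K\<^sup>2)))) \<partial>M)"
    using pt by (intro nn_integral_mono) (simp add: ennreal_leI flip: ennreal_mult)
  also have "\<dots> = ennreal (exp (2 * \<rho> * l\<^sup>2 * c\<^sup>2)) * (\<integral>\<^sup>+x. ennreal (exp (u * ((Y x)\<^sup>2 / (2 * K\<^sup>2)))) \<partial>M)"
    by (rule nn_integral_cmult) measurable
  also have "\<dots> \<le> ennreal (exp (2 * \<rho> * l\<^sup>2 * c\<^sup>2)) * ennreal (4 * C / 3)"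
    by (intro mult_left_mono nnY) auto
  also have "\<dots> = ennreal (4 * C / 3 * exp (2 * \<rho> * l\<^sup>2 * c\<^sup>2))"
    using C by (simp add: mult_ac flip: ennreal_mult)
  finally have nn: "(\<integral>\<^sup>+x. ennreal (exp (\<rho> * (\<Gamma> (\<lambda>x. l * f x) x)\<^sup>2)) \<partial>M)
      \<le> ennreal (4 * C / 3 * exp (2 * \<rho> * l\<^sup>2 * c\<^sup>2))" .
  \<comment> \<open>Finiteness of the nonnegative integral yields the integrability on which the
    Herbst bound rests.\<close>
  have int: "integrable M (\<lambda>x. exp (\<rho> * (\<Gamma> (\<lambda>x. l * f x) x)\<^sup>2))"
    by (rule integrableI_nonneg) (use nn in \<open>auto intro: le_less_trans\<close>)
  have "expectation (\<lambda>x. exp (l * f x - expectation (\<lambda>x. l * f x)))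
      \<le> expectation (\<lambda>x. exp (\<rho> * (\<Gamma> (\<lambda>x. l * f x) x)\<^sup>2))"
    by (rule mLSI_mgf_le[OF diff lsi lf(1) int])
  also have "\<dots> \<le> 4 * C / 3 * exp (2 * \<rho> * l\<^sup>2 * c\<^sup>2)"
    using nn int C by (simp add: nn_integral_eq_integral ennreal_le_iff)
  finally show ?thesis by simp
qed

text \<open>Chernoff's method with the exponent
  \<open>2 * \<rho> * l\<^sup>2 * c\<^sup>2 - l * t\<close>, minimised over the admissible
  \<open>l\<close>. The two terms of the minimum correspond to an interior and to a boundary
  minimiser.\<close>

lemma mLSI_tail_le:
  assumes diff: "difference_operator M A \<Gamma>" and lsi: "mLSI M A \<Gamma> \<rho>" and f: "f \<in> A"
    and g: "g \<in> borel_measurable M"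
    and \<Gamma>g: "\<And>x. x \<in> space M \<Longrightarrow> \<Gamma> f x \<le> g x"
    and c: "c > 0" and C: "C \<ge> 1" and K: "K > 0"
    and tail: "\<And>t. t \<ge> 0 \<Longrightarrow> prob {x \<in> space M. g x \<ge> c + t} \<le> C * exp (- (t\<^sup>2 / (2 * K\<^sup>2)))"
    and t: "t \<ge> 0"
  shows "prob {x \<in> space M. f x - expectation f \<ge> t}
           \<le> 4 * C / 3 * exp (- (1 / 8 * min (t\<^sup>2 / (\<rho> * c\<^sup>2)) (t / (sqrt \<rho> * K))))"
proof -
  have \<rho>: "\<rho> > 0" using lsi by (simp add: mLSI_def)
  note [measurable] = difference_operatorD(1)[OF diff f]
  obtain B where B: "\<And>x. x \<in> space M \<Longrightarrow> \<bar>f x\<bar> \<le> B"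
    using difference_operatorD(2)[OF diff f] by (auto simp: bounded_iff)
  have chernoff: "prob {x \<in> space M. f x - expectation f \<ge> t}
      \<le> 4 * C / 3 * exp (2 * \<rho> * l\<^sup>2 * c\<^sup>2 - l * t)"
    if l: "0 \<le> l" "4 * sqrt \<rho> * K * l \<le> 1" for l
  proof -
    have "\<bar>exp (l * f x - l * expectation f)\<bar> \<le> exp (l * B - l * expectation f)"
      if "x \<in> space M" for x
    proof -
      have "l * f x \<le> l * B" using B[OF that] l by (intro mult_left_mono) auto
      then show ?thesis by simp
    qed
    then have int: "integrable M (\<lambda>x. exp (l * f x - l * expectation f))"
      by (rule integrable_boundedI[rotated]) measurable
    have "prob {x \<in> space M. f x - expectation f \<ge> t}
        \<le> prob {x \<in> space M. exp (l * f x - l * expectation f) \<ge> exp (l * t)}"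
    proof (rule finite_measure_mono)
      have "l * t \<le> l * f x - l * expectation f" if "t \<le> f x - expectation f" for x
        using mult_left_mono[OF that l(1)] by (simp add: algebra_simps)
      then show "{x \<in> space M. f x - expectation f \<ge> t}
          \<subseteq> {x \<in> space M. exp (l * f x - l * expectation f) \<ge> exp (l * t)}" by auto
    qed measurable
    also have "\<dots> \<le> expectation (\<lambda>x. exp (l * f x - l * expectation f)) / exp (l * t)"
      by (rule integral_Markov_inequality_measure[OF int, of "{}"]) auto
    also have "\<dots> \<le> (4 * C / 3 * exp (2 * \<rho> * l\<^sup>2 * c\<^sup>2)) / exp (l * t)"
      by (intro divide_right_mono mLSI_centred_mgf_le[OF diff lsi f g \<Gamma>g c C K tail l]) auto
    finally show ?thesis by (simp add: exp_diff)
  qed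
  show ?thesis
  proof (cases "4 * sqrt \<rho> * K * (t / (4 * \<rho> * c\<^sup>2)) \<le> 1")
    case True
    \<comment> \<open>The unconstrained minimiser of the quadratic exponent, admissible in this
      case.\<close>
    define l where "l = t / (4 * \<rho> * c\<^sup>2)"
    have "2 * \<rho> * l\<^sup>2 * c\<^sup>2 - l * t = - (1 / 8 * (t\<^sup>2 / (\<rho> * c\<^sup>2)))"
      using \<rho> c by (simp add: l_def field_simps power2_eq_square)
    also have "\<dots> \<le> - (1 / 8 * min (t\<^sup>2 / (\<rho> * c\<^sup>2)) (t / (sqrt \<rho> * K)))"
      by simp
    finally have "4 * C / 3 * exp (2 * \<rho> * l\<^sup>2 * c\<^sup>2 - l * t)
        \<le> 4 * C / 3 * exp (- (1 / 8 * min (t\<^sup>2 / (\<rho> * c\<^sup>2)) (t / (sqrt \<rho> * K))))"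
      using C by (intro mult_left_mono) auto
    then show ?thesis using chernoff[of l] True t \<rho> unfolding l_def by force
  next
    case False
    \<comment> \<open>The largest admissible \<open>l\<close>. It lies below the unconstrained
      minimiser, so the quadratic term is at most \<open>l * t / 2\<close>, half of the linear
      one.\<close>
    define l where "l = 1 / (4 * sqrt \<rho> * K)"
    have l: "0 < l" using \<rho> K by (simp add: l_def)
    have "l * (4 * \<rho> * c\<^sup>2) \<le> t" using False \<rho> K c by (simp add: l_def field_simps)
    then have "l * (l * (4 * \<rho> * c\<^sup>2)) \<le> l * t" using l by (intro mult_left_mono) auto
    then have "2 * \<rho> * l\<^sup>2 * c\<^sup>2 - l * t \<le> - (l * t / 2)"
      by (simp add: power2_eq_square algebra_simps)
    also have "\<dots> = - (1 / 8 * (t / (sqrt \<rho> * K)))" by (simp add: l_def)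
    also have "\<dots> \<le> - (1 / 8 * min (t\<^sup>2 / (\<rho> * c\<^sup>2)) (t / (sqrt \<rho> * K)))"
      by simp
    finally have "4 * C / 3 * exp (2 * \<rho> * l\<^sup>2 * c\<^sup>2 - l * t)
        \<le> 4 * C / 3 * exp (- (1 / 8 * min (t\<^sup>2 / (\<rho> * c\<^sup>2)) (t / (sqrt \<rho> * K))))"
      using C by (intro mult_left_mono) auto
    moreover have "4 * sqrt \<rho> * K * l \<le> 1" using \<rho> K by (simp add: l_def)
    ultimately show ?thesis using chernoff[of l] l by force
  qed
qed

end

section \<open>The two-sided inequality\<close>

text \<open>Combines a union bound with the trivial bound \<open>1\<close>: weakening the rate from
  \<open>1 / 8\<close> to \<open>1 / 12\<close> lowers the prefactor from \<open>8 * C / 3\<close>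
  to \<open>2 * C\<close>.\<close>

lemma min_one_exp_le:
  fixes p C m :: real
  assumes "p \<le> 1" "p \<le> 8 * C / 3 * exp (- (1 / 8 * m))" "C \<ge> 1"
  shows "p \<le> 2 * C * exp (- (1 / 12 * m))"
proof -
  \<comment> \<open>Both exponentials are powers of \<open>z\<close>, as
    \<open>1 / 8 = 3 / 24\<close> and \<open>1 / 12 = 2 / 24\<close>.\<close>
  define z where "z = exp (- (m / 24))"
  have z: "exp (- (1 / 8 * m)) = z ^ 3" "exp (- (1 / 12 * m)) = z\<^sup>2" "z > 0"
    by (simp_all add: z_def flip: exp_of_nat_mult)
  show ?thesis
  \<comment> \<open>Up to \<open>3 / 4\<close> the spare factor \<open>z\<close> turns
    \<open>8 / 3\<close> into at most \<open>2\<close>; beyond it \<open>2 * z\<^sup>2\<close>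
    exceeds \<open>9 / 8\<close>, so the claimed bound is above \<open>1\<close>.\<close>
  proof (cases "z \<le> 3 / 4")
    case True
    have "8 * C / 3 * z ^ 3 = (8 * C / 3 * z\<^sup>2) * z" by (simp add: power2_eq_square power3_eq_cube)
    also have "\<dots> \<le> (8 * C / 3 * z\<^sup>2) * (3 / 4)" using True assms by (intro mult_left_mono) auto
    finally have "8 * C / 3 * z ^ 3 \<le> 2 * C * z\<^sup>2" by simp
    then show ?thesis using assms(2) unfolding z by linarith
  next
    case False
    have "1 \<le> 2 * (3 / 4 :: real)\<^sup>2" by (simp add: power2_eq_square)
    also have "\<dots> \<le> (2 * C) * z\<^sup>2" using False assms by (intro mult_mono power_mono) auto
    finally show ?thesis using assms z by simp
  qed
qed

theorem theorem1p1:
  fixes M :: "'a measure"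
    and A :: "('a \<Rightarrow> real) set"
    and \<Gamma> :: "('a \<Rightarrow> real) \<Rightarrow> 'a \<Rightarrow> real"
    and \<rho> c C K :: real
    and f g :: "'a \<Rightarrow> real"
  assumes "prob_space M"
    and "difference_operator M A \<Gamma>"
    and "\<rho> > 0"
    and "mLSI M A \<Gamma> \<rho>"
    and "f \<in> A"
    and "g \<in> borel_measurable M"
    and "\<forall>x\<in>space M. \<Gamma> f x \<le> g x"
    and "c > 0" and "C \<ge> 1" and "K > 0"
    and "\<forall>t\<ge>0. \<P>(x in M. g x \<ge> c + t) \<le> C * exp (- (t\<^sup>2 / (2 * K\<^sup>2)))"
  shows "(\<forall>t\<ge>0. \<P>(x in M. f x - (\<integral>y. f y \<partial>M) \<ge> t)
            \<le> 4 * C / 3 * exp (- (1 / 8 * min (t\<^sup>2 / (\<rho> * c\<^sup>2)) (t / (sqrt \<rho> * K))))) \<and>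
         ((\<forall>h\<in>A. \<forall>a::real. (\<lambda>x. a * h x) \<in> A \<and>
              (\<forall>x\<in>space M. \<Gamma> (\<lambda>y. a * h y) x = \<bar>a\<bar> * \<Gamma> h x)) \<longrightarrow>
          (\<forall>t\<ge>0. \<P>(x in M. \<bar>f x - (\<integral>y. f y \<partial>M)\<bar> \<ge> t)
            \<le> 2 * C * exp (- (1 / 12 * min (t\<^sup>2 / (\<rho> * c\<^sup>2)) (t / (sqrt \<rho> * K))))))"
proof -
  interpret prob_space M by fact
  note upper = mLSI_tail_le[OF assms(2,4) _ assms(6) _ assms(8-10)]
  have up: "prob {x \<in> space M. f x - expectation f \<ge> t}
      \<le> 4 * C / 3 * exp (- (1 / 8 * min (t\<^sup>2 / (\<rho> * c\<^sup>2)) (t / (sqrt \<rho> * K))))" if "t \<ge> 0" for t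
    using assms that by (intro upper) auto
  have [measurable]: "f \<in> borel_measurable M"
    using difference_operatorD(1)[OF assms(2,5)] .
  show ?thesis
  proof (intro conjI impI allI)
    fix t :: real
    assume hom: "\<forall>h\<in>A. \<forall>a::real. (\<lambda>x. a * h x) \<in> A \<and>
        (\<forall>x\<in>space M. \<Gamma> (\<lambda>y. a * h y) x = \<bar>a\<bar> * \<Gamma> h x)" and t: "t \<ge> 0"
    define m where "m = min (t\<^sup>2 / (\<rho> * c\<^sup>2)) (t / (sqrt \<rho> * K))"
    \<comment> \<open>The lower tail of \<open>f\<close> is the upper tail of its negative, for
      which the same \<open>g\<close> dominates because \<open>\<bar>- 1\<bar> = 1\<close>.\<close>
    from hom assms(5) have neg: "(\<lambda>x. - 1 * f x) \<in> A" "\<forall>x\<in>space M. \<Gamma> (\<lambda>x. - 1 * f x) x = \<bar>- 1\<bar> * \<Gamma> f x"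
      by blast+
    have down: "prob {x \<in> space M. - 1 * f x - expectation (\<lambda>x. - 1 * f x) \<ge> t}
        \<le> 4 * C / 3 * exp (- (1 / 8 * m))"
      unfolding m_def by (rule upper[OF neg(1)]) (use assms neg(2) t in auto)
    have "{x \<in> space M. \<bar>f x - expectation f\<bar> \<ge> t} =
        {x \<in> space M. f x - expectation f \<ge> t} \<union>
        {x \<in> space M. - 1 * f x - expectation (\<lambda>x. - 1 * f x) \<ge> t}" by auto
    then have "prob {x \<in> space M. \<bar>f x - expectation f\<bar> \<ge> t} \<le>
        prob {x \<in> space M. f x - expectation f \<ge> t} +
        prob {x \<in> space M. - 1 * f x - expectation (\<lambda>x. - 1 * f x) \<ge> t}"
      by (simp only:) (rule measure_Un_le; measurable)
    also have "\<dots> \<le> 8 * C / 3 * exp (- (1 / 8 * m))"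
      using up[OF t] down by (simp add: m_def)
    finally show "prob {x \<in> space M. \<bar>f x - expectation f\<bar> \<ge> t}
        \<le> 2 * C * exp (- (1 / 12 * min (t\<^sup>2 / (\<rho> * c\<^sup>2)) (t / (sqrt \<rho> * K))))"
      unfolding m_def[symmetric] by (intro min_one_exp_le[OF prob_le_1 _ assms(9)])
  qed (use up in blast)
qed

end
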